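(* For all $n\ge 10$, $\beta_n\ge\alpha_n$ and $\delta_n\ge\gamma_n$, where the sequences are as defined in the context.
   Context: For a positive integer $a$ with decimal expansion $a=\sum_{i=0}^{k} c_i 10^i$, $c_i\in\{0,\dots,9\}$, $c_k\neq 0$, and an integer $b\ge 10$, let $a\_b:=\sum_{i=0}^{k} c_i b^i$ (the decimal digit string of $a$ interpreted in base $b$); this is again a positive integer. Define for $n\ge 10$: $\alpha_{10}=10$ and $\alpha_n = 10\_(11\_(12\_(\cdots\_((n-1)\_n)\cdots)))$ for $n\ge 11$; $\beta_{10}=10$ and $\beta_n = ((\cdots((10\_11)\_12)\cdots)\_(n-1))\_n$ for $n\ge 11$; $\gamma_{10}=10$ and $\gamma_n = n\_((n-1)\_(\cdots\_(12\_(11\_10))\cdots))$ for $n\ge 11$; $\delta_{10}=10$ and $\delta_n = ((\cdots((n\_(n-1))\_(n-2))\cdots)\_11)\_10$ for $n\ge 11$. *)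

theory Defs
  imports Main
begin

text \<open>
  The index set consists exactly of the positions of the decimal digits of \<open>a\<close>;
  \<open>subscript_eq\<close> below is the characterisation by an arbitrary decimal expansion.
\<close>

definition subscript :: "nat \<Rightarrow> nat \<Rightarrow> nat" where
  "subscript a b = (\<Sum>i | 10 ^ i \<le> a. (a div 10 ^ i mod 10) * b ^ i)"

definition alpha :: "nat \<Rightarrow> nat" where
  "alpha n = foldr subscript [10..<n] n"

definition beta :: "nat \<Rightarrow> nat" where
  "beta n = foldl subscript 10 [11..<Suc n]"

definition gamma :: "nat \<Rightarrow> nat" where
  "gamma n = foldr subscript (rev [11..<Suc n]) 10"

definition delta :: "nat \<Rightarrow> nat" where
  "delta n = foldl subscript n (rev [10..<n])"

lemma decimal_sum_less:
  fixes c :: "nat \<Rightarrow> nat"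
  assumes "\<And>i. i < k \<Longrightarrow> c i \<le> 9"
  shows "(\<Sum>i<k. c i * 10 ^ i) < 10 ^ k"
  using assms
proof (induction k)
  case (Suc k)
  have "(\<Sum>i<k. c i * 10 ^ i) < 10 ^ k" using Suc by simp
  moreover have "c k * 10 ^ k \<le> 9 * 10 ^ k" using Suc.prems[of k] by simp
  ultimately show ?case unfolding sum.lessThan_Suc power_Suc by linarith
qed simp

lemma decimal_digit:
  fixes c :: "nat \<Rightarrow> nat"
  assumes "\<And>i. i \<le> k \<Longrightarrow> c i \<le> 9" and "j \<le> k"
  shows "(\<Sum>i\<le>k. c i * 10 ^ i) div 10 ^ j mod 10 = c j"
  using assms
proof (induction j arbitrary: c k)
  case 0
  have "(\<Sum>i\<le>k. c i * 10 ^ i) mod 10 = c 0"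
  proof (cases k)
    case (Suc m)
    have "(\<Sum>i\<le>k. c i * 10 ^ i) = c 0 + 10 * (\<Sum>i\<le>m. c (Suc i) * 10 ^ i)"
      unfolding Suc sum.atMost_Suc_shift by (simp add: sum_distrib_left mult_ac)
    then show ?thesis using 0(1)[of 0] by simp
  qed (use 0(1)[of 0] in simp)
  then show ?case by simp
next
  case (Suc j)
  then obtain m where k: "k = Suc m" by (cases k) auto
  have eq: "(\<Sum>i\<le>k. c i * 10 ^ i) = c 0 + 10 * (\<Sum>i\<le>m. c (Suc i) * 10 ^ i)"
    unfolding k sum.atMost_Suc_shift by (simp add: sum_distrib_left mult_ac)
  have "c 0 \<le> 9" using Suc.prems by simp
  then have "(\<Sum>i\<le>k. c i * 10 ^ i) div 10 = (\<Sum>i\<le>m. c (Suc i) * 10 ^ i)"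
    unfolding eq by simp
  moreover have "(\<Sum>i\<le>m. c (Suc i) * 10 ^ i) div 10 ^ j mod 10 = c (Suc j)"
    by (rule Suc.IH) (use Suc.prems k in auto)
  ultimately show ?case by (simp add: div_mult2_eq)
qed

lemma subscript_eq:
  fixes c :: "nat \<Rightarrow> nat"
  assumes digits: "\<And>i. i \<le> k \<Longrightarrow> c i \<le> 9" and lead: "c k \<noteq> 0"
    and a: "a = (\<Sum>i\<le>k. c i * 10 ^ i)"
  shows "subscript a b = (\<Sum>i\<le>k. c i * b ^ i)"
proof -
  have "a < 10 ^ Suc k"
    using decimal_sum_less[of "Suc k" c] digits unfolding a lessThan_Suc_atMost by simp
  moreover have "10 ^ k \<le> a"
  proof -
    have "10 ^ k \<le> c k * 10 ^ k" using lead by simp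
    also have "\<dots> \<le> a" unfolding a by (rule member_le_sum) auto
    finally show ?thesis .
  qed
  ultimately have "10 ^ i \<le> a \<longleftrightarrow> i \<le> k" for i
    by (meson le_trans linorder_not_le not_less_eq_eq one_le_numeral power_increasing)
  then have "{i. 10 ^ i \<le> a} = {..k}" by auto
  then show ?thesis
    unfolding subscript_def using decimal_digit[OF digits] a by (auto intro: sum.cong)
qed

lemma alpha_10: "alpha 10 = 10" and beta_10: "beta 10 = 10"
  and gamma_10: "gamma 10 = 10" and delta_10: "delta 10 = 10"
  by (simp_all add: alpha_def beta_def gamma_def delta_def)

lemma alpha_13: "alpha 13 = subscript 10 (subscript 11 (subscript 12 13))"
  and beta_13: "beta 13 = subscript (subscript (subscript 10 11) 12) 13"
  and gamma_13: "gamma 13 = subscript 13 (subscript 12 (subscript 11 10))"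
  and delta_13: "delta 13 = subscript (subscript (subscript 13 12) 11) 10"
  by (simp_all add: alpha_def beta_def gamma_def delta_def upt_rec)

end

theory Submission
  imports Defs "HOL-Computational_Algebra.Polynomial"
begin

text \<open>
  If \<open>P\<close> is the polynomial whose coefficients are the decimal digits of \<open>a\<close>, then \<open>P(10) = a\<close>
  and \<open>P(x) = subscript a x\<close>. Among the polynomials with natural coefficients and value \<open>a\<close>
  at \<open>10\<close>, it has the largest value at every \<open>x \<ge> 10\<close>, because a decimal carry trades \<open>10 * x ^ i\<close>
  for \<open>x ^ Suc i\<close>. The composition of the digit polynomials of \<open>a\<close> and \<open>b\<close> has value
  \<open>subscript a b\<close> at \<open>10\<close> and \<open>subscript a (subscript b c)\<close> at \<open>c\<close>, so that
  \<open>subscript a (subscript b c) \<le> subscript (subscript a b) c\<close>: moving brackets to the left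
  never decreases an iterated subscript.
\<close>

lemma subscript_eq_sum_lessThan:
  assumes "a < 10 ^ k"
  shows "subscript a b = (\<Sum>i<k. (a div 10 ^ i mod 10) * b ^ i)"
  unfolding subscript_def
proof (rule sum.mono_neutral_left)
  show "{i. 10 ^ i \<le> a} \<subseteq> {..<k}"
  proof
    fix i assume "i \<in> {i. 10 ^ i \<le> a}"
    then have "10 ^ i \<le> a" by simp
    then have "10 ^ i < (10::nat) ^ k"
      using assms by (rule le_less_trans)
    then show "i \<in> {..<k}" by simp
  qed
qed (auto simp: not_le)

lemma subscript_add_mult_10:
  assumes "d < 10"
  shows "subscript (d + 10 * x) b = d + b * subscript x b"
proof -
  obtain k where k: "x < 10 ^ k"
    using power_gt_expt[of 10 x] by auto
  then have "d + 10 * x < 10 ^ Suc k"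
    using assms by simp
  then have "subscript (d + 10 * x) b
      = (\<Sum>i<Suc k. ((d + 10 * x) div 10 ^ i mod 10) * b ^ i)"
    by (rule subscript_eq_sum_lessThan)
  also have "\<dots> = d + (\<Sum>i<k. b * ((x div 10 ^ i mod 10) * b ^ i))"
    using assms by (simp add: sum.lessThan_Suc_shift div_mult2_eq mult_ac del: sum.lessThan_Suc)
  also have "\<dots> = d + b * subscript x b"
    using k by (simp add: subscript_eq_sum_lessThan sum_distrib_left)
  finally show ?thesis .
qed

lemma decimal_induct [case_names zero append_digit]:
  fixes a :: nat
  assumes "P 0" and "\<And>d x. \<lbrakk>d < 10; P x\<rbrakk> \<Longrightarrow> P (d + 10 * x)"
  shows "P a"
proof (induction a rule: less_induct)
  case (less a)
  show ?case
  proof (cases "a = 0")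
    case False
    have "P (a mod 10 + 10 * (a div 10))"
      using False less by (intro assms(2)) auto
    then show ?thesis by simp
  qed (use assms(1) in simp)
qed

lemma subscript_0_left [simp]: "subscript 0 b = 0"
  by (simp add: subscript_def)

lemma subscript_10_right: "subscript a 10 = a"
  by (induction a rule: decimal_induct) (simp_all add: subscript_add_mult_10)

lemma strict_mono_subscript:
  assumes "10 \<le> b"
  shows "strict_mono (\<lambda>a. subscript a b)"
  unfolding strict_mono_Suc_iff
proof
  fix a
  show "subscript a b < subscript (Suc a) b"
  proof (induction a rule: decimal_induct)
    case zero
    show ?case using subscript_add_mult_10[of 1 0 b] by simp
  next
    case (append_digit d x)
    consider (no_carry) "Suc d < 10" | (carry) "d = 9" using append_digit.hyps by linarith
    then show ?case
    proof cases
      case no_carry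
      then show ?thesis
        using subscript_add_mult_10[of d x b] subscript_add_mult_10[of "Suc d" x b] by simp
    next
      case carry
      have "subscript (d + 10 * x) b = 9 + b * subscript x b"
        using carry by (simp add: subscript_add_mult_10)
      also have "\<dots> < b * Suc (subscript x b)"
        using assms by simp
      also have "\<dots> \<le> b * subscript (Suc x) b"
        using append_digit.IH by (intro mult_le_mono2 Suc_leI)
      also have "\<dots> = subscript (Suc (d + 10 * x)) b"
        using subscript_add_mult_10[of 0 "Suc x" b] carry by simp
      finally show ?thesis .
    qed
  qed
qed

lemma add_mult_subscript_le:
  assumes "10 \<le> b"
  shows "c + b * subscript x b \<le> subscript (c + 10 * x) b"
proof -
  have add_le: "subscript x b + q \<le> subscript (x + q) b" for q
    using strict_monoD[OF strict_mono_subscript[OF assms]] by (rule mono_nat_linear_lb)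
  define q d where "q = c div 10" and "d = c mod 10"
  then have c: "c = d + 10 * q" and "d < 10" by simp_all
  have "c + b * subscript x b \<le> d + b * (subscript x b + q)"
    using assms by (simp add: c distrib_left)
  also have "\<dots> \<le> d + b * subscript (x + q) b"
    using add_le by simp
  also have "\<dots> = subscript (c + 10 * x) b"
    using subscript_add_mult_10[OF \<open>d < 10\<close>, of "x + q" b] by (simp add: c distrib_left ac_simps)
  finally show ?thesis .
qed

lemma poly_le_subscript_poly_10:
  assumes "10 \<le> b"
  shows "poly p b \<le> subscript (poly p 10) b"
proof (induction p)
  case (pCons c p)
  then have "poly (pCons c p) b \<le> c + b * subscript (poly p 10) b" by simp
  also have "\<dots> \<le> subscript (poly (pCons c p) 10) b"
    using add_mult_subscript_le[OF assms] by simp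
  finally show ?case .
qed simp

definition digit_poly :: "nat \<Rightarrow> nat poly" where
  "digit_poly a = (\<Sum>i | 10 ^ i \<le> a. monom (a div 10 ^ i mod 10) i)"

lemma poly_digit_poly: "poly (digit_poly a) b = subscript a b"
  by (simp add: digit_poly_def subscript_def poly_sum poly_monom)

lemma subscript_assoc_le:
  assumes "10 \<le> c"
  shows "subscript a (subscript b c) \<le> subscript (subscript a b) c"
proof -
  define p where "p = digit_poly a \<circ>\<^sub>p digit_poly b"
  have "poly p x = subscript a (subscript b x)" for x
    by (simp add: p_def poly_pcompose poly_digit_poly)
  then show ?thesis
    using poly_le_subscript_poly_10[OF assms, of p] by (simp add: subscript_10_right)
qed

lemma foldr_le_foldl:
  fixes f :: "'a::preorder \<Rightarrow> 'a \<Rightarrow> 'a"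
  assumes closed: "\<And>a b. \<lbrakk>a \<in> S; b \<in> S\<rbrakk> \<Longrightarrow> f a b \<in> S"
    and assoc_le: "\<And>a b c. \<lbrakk>a \<in> S; b \<in> S; c \<in> S\<rbrakk> \<Longrightarrow> f a (f b c) \<le> f (f a b) c"
    and "a \<in> S" and "set bs \<subseteq> S" and "c \<in> S"
  shows "foldr f (a # bs) c \<le> foldl f a (bs @ [c])"
  using \<open>a \<in> S\<close> \<open>set bs \<subseteq> S\<close>
proof (induction bs arbitrary: a)
  case (Cons b bs)
  have "foldr f bs c \<in> S"
    using Cons.prems \<open>c \<in> S\<close> by (induction bs) (auto intro: closed)
  then have "f a (f b (foldr f bs c)) \<le> f (f a b) (foldr f bs c)"
    using Cons.prems by (intro assoc_le) auto
  also have "\<dots> \<le> foldl f (f a b) (bs @ [c])"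
    using Cons.IH[of "f a b"] Cons.prems closed by simp
  finally show ?case by simp
qed simp

lemma foldr_subscript_le_foldl_subscript:
  assumes "set (a # bs) \<subseteq> {10..}" and "10 \<le> c"
  shows "foldr subscript (a # bs) c \<le> foldl subscript a (bs @ [c])"
proof (rule foldr_le_foldl[where S = "{10..}"])
  fix a b :: nat
  assume "a \<in> {10..}" "b \<in> {10..}"
  then show "subscript a b \<in> {10..}"
    using strict_mono_imp_increasing[OF strict_mono_subscript[of b], of a] by simp
qed (use assms subscript_assoc_le in auto)

theorem theorem2:
  fixes n :: nat
  assumes "n \<ge> 10"
  shows "beta n \<ge> alpha n \<and> delta n \<ge> gamma n"
proof (cases "n = 10")
  case True
  then show ?thesis by (simp add: alpha_10 beta_10 gamma_10 delta_10)
next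
  case False
  with assms have "11 \<le> n" by simp
  then have upt: "[10..<n] = 10 # [11..<n]" "[11..<Suc n] = [11..<n] @ [n]"
    by (simp_all add: upt_conv_Cons)
  have "alpha n \<le> beta n"
    unfolding alpha_def beta_def upt
    using \<open>11 \<le> n\<close> by (intro foldr_subscript_le_foldl_subscript) auto
  moreover have "foldr subscript (n # rev [11..<n]) 10 \<le> foldl subscript n (rev [11..<n] @ [10])"
    using \<open>11 \<le> n\<close> by (intro foldr_subscript_le_foldl_subscript) auto
  then have "gamma n \<le> delta n"
    by (simp add: gamma_def delta_def upt del: upt_Suc)
  ultimately show ?thesis by simp
qed

end
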